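(* Let a connected undirected graph on the nodes $\{1,\dots,n\}$ be given, with neighborhoods $\mathcal N_i$ ($i\notin\mathcal N_i$), and let $L$ be the number of ordered pairs (arcs) $(i,j)$ with $j\in\mathcal N_i$. Let the local costs $f_i:\mathbb R^p\to\mathbb R$, $i=1,\dots,n$, be closed, proper, and convex, let $f(\mathbf s)=\sum_{i=1}^n f_i(\mathbf s_i)$ for $\mathbf s=[\mathbf s_1^\top\cdots\mathbf s_n^\top]^\top\in\mathbb R^{np}$, and assume that the problem $$\min_{\mathbf s\in\mathbb R^{np},\,\mathbf z\in\mathbb R^{Lp}} f(\mathbf s)\quad\text{subject to}\quad \mathbf A\mathbf s+\mathbf B\mathbf z=\mathbf 0\qquad(\mathrm P)$$ (matrices defined in the context) has at least one pair of primal-dual solutions. Let $c>0$ be the ADMM penalty parameter, and consider the decentralized ADMM iterations carried out at every node $i$, $$\mathbf v_i(k)=\mathbf v_i(k-1)+c\sum_{j\in\mathcal N_i}[\mathbf s_i(k)-\mathbf s_j(k)],$$ $$\mathbf s_i(k+1)=\arg\min_{\mathbf s_i}\Big\{f_i(\mathbf s_i)+\mathbf v_i(k)^\top\mathbf s_i+c\sum_{j\in\mathcal N_i}\Big\|\mathbf s_i-\frac{\mathbf s_i(k)+\mathbf s_j(k)}{2}\Big\|^2\Big\},$$ where $\mathbf v_i(k)=2\sum_{j\in\mathcal N_i}\bar{\mathbf v}_i^{\,j}(k)$, and where the multipliers $\bar{\mathbf v}(k),\tilde{\mathbf v}(k)$ and auxiliary variables $\mathbf z(k)$ underlying these iterations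 are described in the context. If the initial multiplier $\mathbf v(0)=[\bar{\mathbf v}(0)^\top\ \tilde{\mathbf v}(0)^\top]^\top$ satisfies $\bar{\mathbf v}(0)=-\tilde{\mathbf v}(0)$, and $\mathbf z(0)$ is such that $\mathbf E_u\mathbf s(0)=2\mathbf z(0)$, then the iterates $\mathbf s(k)$ and $\bar{\mathbf v}(k)$ converge to a pair of optimal primal and dual solutions of $(\mathrm P)$.
   Context: Graph matrices. Every undirected edge $\{i,j\}$ is represented by the two arcs $(i,j)$ and $(j,i)$; arcs are enumerated $e=1,\dots,L$. The block edge source matrix $\mathbf A_s\in\mathbb R^{Lp\times np}$ has $(e,i)$ block $\mathbf I_p$ if arc $e$ originates at node $i$, and $\mathbf 0$ otherwise. The block edge destination matrix $\mathbf A_d\in\mathbb R^{Lp\times np}$ has $(e,j)$ block $\mathbf I_p$ if arc $e$ terminates at node $j$, and $\mathbf 0$ otherwise. Put $\mathbf E_u=\mathbf A_s+\mathbf A_d$, $\mathbf A=[\mathbf A_s^\top\ \mathbf A_d^\top]^\top\in\mathbb R^{2Lp\times np}$, $\mathbf B=[-\mathbf I_{Lp}\ \ -\mathbf I_{Lp}]^\top\in\mathbb R^{2Lp\times Lp}$. With $\mathbf z=[\mathbf z_1^\top\cdots\mathbf z_L^\top]^\top$ and $\mathbf z_e=\mathbf z_i^{\,j}\in\mathbb R^p$ for $e=(i,j)$, the constraint in $(\mathrm P)$ says $\mathbf s_i=\mathbf z_i^{\,j}$ and $\mathbf s_j=\mathbf z_i^{\,j}$ for every arc $(i,j)$; equivalently,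 $\mathbf A_s\mathbf s-\mathbf z=\mathbf 0$ and $\mathbf A_d\mathbf s-\mathbf z=\mathbf 0$. Multipliers. $\bar{\mathbf v}\in\mathbb R^{Lp}$ stacks the multipliers $\bar{\mathbf v}_i^{\,j}$ of $\mathbf s_i=\mathbf z_i^{\,j}$ and $\tilde{\mathbf v}\in\mathbb R^{Lp}$ stacks the multipliers $\tilde{\mathbf v}_i^{\,j}$ of $\mathbf s_j=\mathbf z_i^{\,j}$, over all arcs $(i,j)$. The augmented Lagrangian is $L_c(\mathbf s,\mathbf z,\mathbf v)=f(\mathbf s)+\mathbf v^\top(\mathbf A\mathbf s+\mathbf B\mathbf z)+\frac c2\|\mathbf A\mathbf s+\mathbf B\mathbf z\|^2$ with $\mathbf v=[\bar{\mathbf v}^\top\ \tilde{\mathbf v}^\top]^\top$. Where the iterations come from. They are the reduced form of the ADMM for $(\mathrm P)$, whose steps are $\bar{\mathbf v}_i^{\,j}(k)=\bar{\mathbf v}_i^{\,j}(k-1)+c[\mathbf s_i(k)-\mathbf z_i^{\,j}(k)]$, $\tilde{\mathbf v}_i^{\,j}(k)=\tilde{\mathbf v}_i^{\,j}(k-1)+c[\mathbf s_j(k)-\mathbf z_i^{\,j}(k)]$, $\mathbf s(k+1)=\arg\min_{\mathbf s}L_c(\mathbf s,\mathbf z(k),\mathbf v(k))$, $\mathbf z(k+1)=\arg\min_{\mathbf z}L_c(\mathbf s(k+1),\mathbf z,\mathbf v(k))$. In the reduced form, $\mathbf z$ and the individual multipliers have been eliminated, only the scaled sum $\mathbf v_i(k)=2\sum_{j\in\mathcal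 N_i}\bar{\mathbf v}_i^{\,j}(k)$ being kept at node $i$. This reduction is derived for multipliers initialized to zero. When $\bar{\mathbf v}(0)=-\tilde{\mathbf v}(0)$, the $\mathbf z$-step gives $\mathbf z_i^{\,j}(k)=\frac12[\mathbf s_i(k)+\mathbf s_j(k)]$, so $\bar{\mathbf v}_i^{\,j}(k)=\bar{\mathbf v}_i^{\,j}(k-1)+\frac c2[\mathbf s_i(k)-\mathbf s_j(k)]$. Optimality. A pair of optimal primal and dual solutions of $(\mathrm P)$ consists of a primal optimal $(\mathbf s^*,\mathbf z^* )$ and an optimal multiplier $\mathbf v^*=[(\bar{\mathbf v}^* )^\top\ (\tilde{\mathbf v}^* )^\top]^\top$, where $\bar{\mathbf v}^*=-\tilde{\mathbf v}^*$; convergence means $\mathbf s(k)\to\mathbf s^*$ and $\bar{\mathbf v}(k)\to\bar{\mathbf v}^*$ as $k\to\infty$ for some such pair. These solutions need not be unique, and the limit depends on $\mathbf s(0)$ and $\bar{\mathbf v}(0)$. $\|\cdot\|$ is the Euclidean norm.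
   Formalization: Node iterations also need Σ_j[v̄_i^j(0)+v̄_j^i(0)]=0 at each i; else false: n=2, f_i=x²/2, v̄_1^2(0)=v̄_2^1(0)=1, s(0)=z(0)=0 gives s(k)→−2, optimum 0. For ADMM with the L_c s-step, any v̄(0)=−ṽ(0) works. *)

theory Defs
  imports "HOL-Analysis.Analysis"
begin

text \<open>
  A graph on the node type \<open>'n\<close> is given by its neighbourhoods \<open>N i\<close>. Arcs are indexed by
  themselves, as ordered pairs, rather than by an enumeration \<open>1, \<dots>, L\<close>. A vector of
  $R^{np}$ is an element of \<open>real^'p^'n\<close>. Since the set of arcs depends on the graph (and is
  empty if there is only one node), a vector of $R^{Lp}$ is a function on
  \<open>'n \<times> 'n\<close> of which only the values on \<open>arcs N\<close> are ever used.
\<close>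

definition arcs :: "('n \<Rightarrow> 'n set) \<Rightarrow> ('n \<times> 'n) set" where
  "arcs N = {(i, j). j \<in> N i}"

definition connected_graph :: "('n \<Rightarrow> 'n set) \<Rightarrow> bool" where
  "connected_graph N \<longleftrightarrow>
     (\<forall>i. i \<notin> N i) \<and> (\<forall>i j. j \<in> N i \<longleftrightarrow> i \<in> N j) \<and> (\<forall>i j. (i, j) \<in> (arcs N)\<^sup>*)"

text \<open>Properness needs no clause, because the function is real-valued.\<close>

definition closed_proper_convex :: "(real^'p \<Rightarrow> real) \<Rightarrow> bool" where
  "closed_proper_convex g \<longleftrightarrow> closed (epigraph UNIV g) \<and> convex_on UNIV g"

definition total_cost :: "('n::finite \<Rightarrow> real^'p \<Rightarrow> real) \<Rightarrow> real^'p^'n \<Rightarrow> real" where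
  "total_cost f s = (\<Sum>i\<in>UNIV. f i (s $ i))"

text \<open>
  Block matrices map a row index and a column index to a \<open>p \<times> p\<close> block. The row indices of
  the stacked matrices \<open>A\<close> and \<open>B\<close> are \<open>Inl e\<close> for the constraint
  $s_i = z_e$ and \<open>Inr e\<close> for $s_j = z_e$, where $e = (i, j)$.
\<close>

type_synonym ('r, 'c, 'p) block_matrix = "'r \<Rightarrow> 'c \<Rightarrow> real^'p^'p"

definition block_mult ::
  "('r, 'c, 'p::finite) block_matrix \<Rightarrow> 'c set \<Rightarrow> ('c \<Rightarrow> real^'p) \<Rightarrow> 'r \<Rightarrow> real^'p" where
  "block_mult M C x r = (\<Sum>c\<in>C. M r c *v x c)"

definition block_transpose :: "('r, 'c, 'p) block_matrix \<Rightarrow> ('c, 'r, 'p::finite) block_matrix" where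
  "block_transpose M c r = transpose (M r c)"

definition A_s :: "('n \<times> 'n, 'n, 'p::finite) block_matrix" where
  "A_s e i = (if fst e = i then mat 1 else 0)"

definition A_d :: "('n \<times> 'n, 'n, 'p::finite) block_matrix" where
  "A_d e j = (if snd e = j then mat 1 else 0)"

definition E_u :: "('n \<times> 'n, 'n, 'p::finite) block_matrix" where
  "E_u e i = A_s e i + A_d e i"

definition mat_A :: "('n \<times> 'n + 'n \<times> 'n, 'n, 'p::finite) block_matrix" where
  "mat_A = case_sum A_s A_d"

definition neg_id :: "('n \<times> 'n, 'n \<times> 'n, 'p::finite) block_matrix" where
  "neg_id e e' = (if e = e' then - mat 1 else 0)"

definition mat_B :: "('n \<times> 'n + 'n \<times> 'n, 'n \<times> 'n, 'p::finite) block_matrix" where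
  "mat_B = case_sum neg_id neg_id"

definition row_indices :: "('n \<Rightarrow> 'n set) \<Rightarrow> ('n \<times> 'n + 'n \<times> 'n) set" where
  "row_indices N = arcs N <+> arcs N"

definition residual ::
  "('n::finite \<Rightarrow> 'n set) \<Rightarrow> real^'p^'n \<Rightarrow> ('n \<times> 'n \<Rightarrow> real^'p)
    \<Rightarrow> 'n \<times> 'n + 'n \<times> 'n \<Rightarrow> real^'p::finite" where
  "residual N s z r = block_mult mat_A UNIV (\<lambda>i. s $ i) r + block_mult mat_B (arcs N) z r"

definition lagrangian ::
  "('n::finite \<Rightarrow> 'n set) \<Rightarrow> ('n \<Rightarrow> real^'p \<Rightarrow> real)
    \<Rightarrow> real^'p^'n \<Rightarrow> ('n \<times> 'n \<Rightarrow> real^'p) \<Rightarrow> ('n \<times> 'n + 'n \<times> 'n \<Rightarrow> real^'p::finite) \<Rightarrow> real" where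
  "lagrangian N f s z v = total_cost f s + (\<Sum>r\<in>row_indices N. v r \<bullet> residual N s z r)"

definition aug_lagrangian ::
  "('n::finite \<Rightarrow> 'n set) \<Rightarrow> ('n \<Rightarrow> real^'p \<Rightarrow> real) \<Rightarrow> real
    \<Rightarrow> real^'p^'n \<Rightarrow> ('n \<times> 'n \<Rightarrow> real^'p) \<Rightarrow> ('n \<times> 'n + 'n \<times> 'n \<Rightarrow> real^'p::finite) \<Rightarrow> real" where
  "aug_lagrangian N f c s z v =
     lagrangian N f s z v + c / 2 * (L2_set (\<lambda>r. norm (residual N s z r)) (row_indices N))\<^sup>2"

subsection \<open>Primal and dual solutions\<close>

definition feasible ::
  "('n::finite \<Rightarrow> 'n set) \<Rightarrow> real^'p^'n \<Rightarrow> ('n \<times> 'n \<Rightarrow> real^'p::finite) \<Rightarrow> bool" where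
  "feasible N s z \<longleftrightarrow> (\<forall>r\<in>row_indices N. residual N s z r = 0)"

definition primal_optimal ::
  "('n::finite \<Rightarrow> 'n set) \<Rightarrow> ('n \<Rightarrow> real^'p \<Rightarrow> real)
    \<Rightarrow> real^'p^'n \<Rightarrow> ('n \<times> 'n \<Rightarrow> real^'p::finite) \<Rightarrow> bool" where
  "primal_optimal N f s z \<longleftrightarrow>
     feasible N s z \<and> (\<forall>s' z'. feasible N s' z' \<longrightarrow> total_cost f s \<le> total_cost f s')"

definition dual_value ::
  "('n::finite \<Rightarrow> 'n set) \<Rightarrow> ('n \<Rightarrow> real^'p \<Rightarrow> real)
    \<Rightarrow> ('n \<times> 'n + 'n \<times> 'n \<Rightarrow> real^'p::finite) \<Rightarrow> ereal" where
  "dual_value N f v = (INF s. INF z. ereal (lagrangian N f s z v))"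

definition dual_optimal ::
  "('n::finite \<Rightarrow> 'n set) \<Rightarrow> ('n \<Rightarrow> real^'p \<Rightarrow> real)
    \<Rightarrow> ('n \<times> 'n + 'n \<times> 'n \<Rightarrow> real^'p::finite) \<Rightarrow> bool" where
  "dual_optimal N f v \<longleftrightarrow> (\<forall>w. dual_value N f w \<le> dual_value N f v)"

text \<open>
  As usual for a primal-dual pair, the dual solution is a Lagrange multiplier, i.e. there is
  no duality gap; for this problem that is automatic.
\<close>

definition optimal_pair ::
  "('n::finite \<Rightarrow> 'n set) \<Rightarrow> ('n \<Rightarrow> real^'p \<Rightarrow> real) \<Rightarrow> real^'p^'n \<Rightarrow> ('n \<times> 'n \<Rightarrow> real^'p)
    \<Rightarrow> ('n \<times> 'n \<Rightarrow> real^'p) \<Rightarrow> ('n \<times> 'n \<Rightarrow> real^'p::finite) \<Rightarrow> bool" where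
  "optimal_pair N f s z vb vt \<longleftrightarrow>
     primal_optimal N f s z \<and> dual_optimal N f (case_sum vb vt) \<and>
     dual_value N f (case_sum vb vt) = ereal (total_cost f s) \<and>
     (\<forall>e\<in>arcs N. vb e = - vt e)"

subsection \<open>Iterations\<close>

text \<open>
  The equation \<open>x = arg min g\<close> is read as: \<open>x\<close> is the only minimizer of \<open>g\<close>. As soon as there
  are two nodes, the minimizers in the \<open>s\<close>-steps are unique by strong convexity; uniqueness
  is a condition only for a graph with one node and no arcs.
\<close>

definition unique_arg_min :: "('a \<Rightarrow> real) \<Rightarrow> 'a \<Rightarrow> bool" where
  "unique_arg_min g x \<longleftrightarrow> {y. is_arg_min g (\<lambda>_. True) y} = {x}"

text \<open>
  The steps of the ADMM that do not concern \<open>s\<close>. In the \<open>z\<close>-step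
  the objective determines \<open>z\<close> only on the arcs, so uniqueness cannot be asked for.
\<close>

definition multiplier_steps ::
  "('n::finite \<Rightarrow> 'n set) \<Rightarrow> real \<Rightarrow> (nat \<Rightarrow> real^'p^'n) \<Rightarrow> (nat \<Rightarrow> 'n \<times> 'n \<Rightarrow> real^'p)
    \<Rightarrow> (nat \<Rightarrow> 'n \<times> 'n \<Rightarrow> real^'p) \<Rightarrow> (nat \<Rightarrow> 'n \<times> 'n \<Rightarrow> real^'p::finite) \<Rightarrow> bool" where
  "multiplier_steps N c s z vb vt \<longleftrightarrow>
     (\<forall>k. \<forall>(i, j)\<in>arcs N.
        vb (Suc k) (i, j) = vb k (i, j) + c *\<^sub>R (s (Suc k) $ i - z (Suc k) (i, j)) \<and>
        vt (Suc k) (i, j) = vt k (i, j) + c *\<^sub>R (s (Suc k) $ j - z (Suc k) (i, j)))"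

definition z_steps ::
  "('n::finite \<Rightarrow> 'n set) \<Rightarrow> ('n \<Rightarrow> real^'p \<Rightarrow> real) \<Rightarrow> real
    \<Rightarrow> (nat \<Rightarrow> real^'p^'n) \<Rightarrow> (nat \<Rightarrow> 'n \<times> 'n \<Rightarrow> real^'p)
    \<Rightarrow> (nat \<Rightarrow> 'n \<times> 'n \<Rightarrow> real^'p) \<Rightarrow> (nat \<Rightarrow> 'n \<times> 'n \<Rightarrow> real^'p::finite) \<Rightarrow> bool" where
  "z_steps N f c s z vb vt \<longleftrightarrow>
     (\<forall>k. is_arg_min (\<lambda>y. aug_lagrangian N f c (s (Suc k)) y (case_sum (vb k) (vt k)))
            (\<lambda>_. True) (z (Suc k)))"

definition admm_s_steps ::
  "('n::finite \<Rightarrow> 'n set) \<Rightarrow> ('n \<Rightarrow> real^'p \<Rightarrow> real) \<Rightarrow> real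
    \<Rightarrow> (nat \<Rightarrow> real^'p^'n) \<Rightarrow> (nat \<Rightarrow> 'n \<times> 'n \<Rightarrow> real^'p)
    \<Rightarrow> (nat \<Rightarrow> 'n \<times> 'n \<Rightarrow> real^'p) \<Rightarrow> (nat \<Rightarrow> 'n \<times> 'n \<Rightarrow> real^'p::finite) \<Rightarrow> bool" where
  "admm_s_steps N f c s z vb vt \<longleftrightarrow>
     (\<forall>k. unique_arg_min (\<lambda>x. aug_lagrangian N f c x (z k) (case_sum (vb k) (vt k)))
            (s (Suc k)))"

definition decentralized_iterations ::
  "('n::finite \<Rightarrow> 'n set) \<Rightarrow> ('n \<Rightarrow> real^'p \<Rightarrow> real) \<Rightarrow> real
    \<Rightarrow> (nat \<Rightarrow> real^'p^'n) \<Rightarrow> (nat \<Rightarrow> 'n \<Rightarrow> real^'p::finite) \<Rightarrow> bool" where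
  "decentralized_iterations N f c s v \<longleftrightarrow>
     (\<forall>k i. v (Suc k) i = v k i + c *\<^sub>R (\<Sum>j\<in>N i. s (Suc k) $ i - s (Suc k) $ j)) \<and>
     (\<forall>k i. unique_arg_min
        (\<lambda>x. f i x + v k i \<bullet> x
              + c * (\<Sum>j\<in>N i. (norm (x - (1/2) *\<^sub>R (s k $ i + s k $ j)))\<^sup>2))
        (s (Suc k) $ i))"

definition node_multiplier ::
  "('n \<Rightarrow> 'n set) \<Rightarrow> ('n \<times> 'n \<Rightarrow> real^'p) \<Rightarrow> 'n \<Rightarrow> real^'p::finite" where
  "node_multiplier N vb i = 2 *\<^sub>R (\<Sum>j\<in>N i. vb (i, j))"

text \<open>
  In the \<open>s\<close>-step for the augmented Lagrangian the linear term is $A^T v$, whereas the decentralized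
  iterations use \<open>node_multiplier N vb\<close>. They are a reduced form of the ADMM
  precisely when the two agree initially (then they agree at every step). This
  is so for zero multipliers and, more generally, if \<open>vb (i, j) = - vb (j, i)\<close> on all
  arcs, but does not follow from \<open>vb = - vt\<close>.
\<close>

definition reduction_valid ::
  "('n \<Rightarrow> 'n set) \<Rightarrow> ('n \<times> 'n \<Rightarrow> real^'p) \<Rightarrow> ('n \<times> 'n \<Rightarrow> real^'p::finite) \<Rightarrow> bool" where
  "reduction_valid N vb vt \<longleftrightarrow>
     (\<forall>i. block_mult (block_transpose mat_A) (row_indices N) (case_sum vb vt) i = node_multiplier N vb i)"

definition converges_to_optimal_pair ::
  "('n::finite \<Rightarrow> 'n set) \<Rightarrow> ('n \<Rightarrow> real^'p \<Rightarrow> real)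
    \<Rightarrow> (nat \<Rightarrow> real^'p^'n) \<Rightarrow> (nat \<Rightarrow> 'n \<times> 'n \<Rightarrow> real^'p::finite) \<Rightarrow> bool" where
  "converges_to_optimal_pair N f s vb \<longleftrightarrow>
     (\<exists>s' z' vb' vt'. optimal_pair N f s' z' vb' vt' \<and>
        s \<longlonglongrightarrow> s' \<and> (\<forall>e\<in>arcs N. (\<lambda>k. vb k e) \<longlonglongrightarrow> vb' e))"

end

theory Submission
  imports Defs
begin

text \<open>
  The hypotheses on the initial values force \<open>vt = - vb\<close> and \<open>z (i, j) = (s i + s j) / 2\<close> in every
  step, and the decentralized iterations are then the ADMM itself. The optimality condition of the
  \<open>s\<close>-step, combined with that of a primal-dual solution \<open>(x, \<mu>)\<close>, shows that
  \<open>\<Sum>e. |vb e - \<mu> e|\<^sup>2 + c\<^sup>2 |z e - x|\<^sup>2\<close> decreases, in each step by at least its analogue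
  for the increments of \<open>vb\<close> and \<open>z\<close>. So the iterates are bounded with vanishing increments.
  A cluster point of \<open>(vb, z)\<close> again satisfies the optimality conditions; measured from it, the
  decreasing quantity tends to 0 along a subsequence, hence altogether. A graph without arcs has
  a single node, and there \<open>s\<close> is constant from step 1 on.
\<close>

subsection \<open>The augmented Lagrangian as a sum over arcs\<close>

lemma neg_mat_1_mult: "(- mat 1) *v x = - (x :: real^'p)"
  using matrix_vector_mult_diff_rdistrib[of 0 "mat 1" x] by simp

lemma residual_Inl:
  assumes "e \<in> arcs N"
  shows "residual N x y (Inl e) = x $ fst e - y e"
proof -
  have "block_mult mat_A UNIV (\<lambda>i. x $ i) (Inl e) = x $ fst e"
    by (simp add: block_mult_def mat_A_def A_s_def if_distrib[of "\<lambda>M. M *v _"] cong: if_cong)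
  moreover have "block_mult mat_B (arcs N) y (Inl e) = - y e"
    using assms
    by (simp add: block_mult_def mat_B_def neg_id_def if_distrib[of "\<lambda>M. M *v _"]
        neg_mat_1_mult cong: if_cong)
  ultimately show ?thesis by (simp add: residual_def)
qed

lemma residual_Inr:
  assumes "e \<in> arcs N"
  shows "residual N x y (Inr e) = x $ snd e - y e"
proof -
  have "block_mult mat_A UNIV (\<lambda>i. x $ i) (Inr e) = x $ snd e"
    by (simp add: block_mult_def mat_A_def A_d_def if_distrib[of "\<lambda>M. M *v _"] cong: if_cong)
  moreover have "block_mult mat_B (arcs N) y (Inr e) = - y e"
    using assms
    by (simp add: block_mult_def mat_B_def neg_id_def if_distrib[of "\<lambda>M. M *v _"]
        neg_mat_1_mult cong: if_cong)
  ultimately show ?thesis by (simp add: residual_def)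
qed

lemma sum_row_indices:
  fixes N :: "'n::finite \<Rightarrow> 'n set"
  shows "(\<Sum>r\<in>row_indices N. g r) = (\<Sum>e\<in>arcs N. g (Inl e) + g (Inr e))"
  by (simp add: row_indices_def sum.Plus sum.distrib)

lemma feasible_iff:
  "feasible N x y \<longleftrightarrow> (\<forall>e\<in>arcs N. x $ fst e = y e \<and> x $ snd e = y e)"
proof -
  have "feasible N x y \<longleftrightarrow> (\<forall>e\<in>arcs N. residual N x y (Inl e) = 0 \<and> residual N x y (Inr e) = 0)"
    unfolding feasible_def row_indices_def by (blast elim: PlusE)
  then show ?thesis by (simp add: residual_Inl residual_Inr)
qed

lemma lagrangian_arcs:
  "lagrangian N f x y v = total_cost f x +
     (\<Sum>e\<in>arcs N. v (Inl e) \<bullet> (x $ fst e - y e) + v (Inr e) \<bullet> (x $ snd e - y e))"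
  by (simp add: lagrangian_def sum_row_indices residual_Inl residual_Inr)

text \<open>On each arc the two occurrences of \<open>y\<close> cancel, so for antisymmetric
  multipliers the Lagrangian depends on \<open>x\<close> alone.\<close>

lemma lagrangian_antisym:
  assumes "\<forall>e\<in>arcs N. vb e = - vt e"
  shows "lagrangian N f x y (case_sum vb vt) =
     total_cost f x + (\<Sum>e\<in>arcs N. vb e \<bullet> (x $ fst e - x $ snd e))"
  unfolding lagrangian_arcs using assms
  by (auto intro!: sum.cong simp: inner_diff_right)

lemma aug_lagrangian_arcs:
  "aug_lagrangian N f c x y v = lagrangian N f x y v +
     (\<Sum>e\<in>arcs N. c / 2 * ((norm (x $ fst e - y e))\<^sup>2 + (norm (x $ snd e - y e))\<^sup>2))"
  by (simp add: aug_lagrangian_def L2_set_def sum_nonneg sum_row_indices residual_Inl residual_Inr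
      sum_distrib_left)

text \<open>With antisymmetric multipliers the Lagrangian part is constant in \<open>y\<close>, so
  the step minimizes the penalty alone, which decouples over the arcs.\<close>

lemma z_step_midpoint:
  fixes x :: "real^'p^'n::finite"
  assumes "c > 0" and anti: "\<forall>e\<in>arcs N. vb e = - vt e"
    and min: "is_arg_min (\<lambda>y. aug_lagrangian N f c x y (case_sum vb vt)) (\<lambda>_. True) y"
    and e: "e \<in> arcs N"
  shows "y e = (1/2) *\<^sub>R (x $ fst e + x $ snd e)"
proof -
  define m where "m e = (1/2) *\<^sub>R (x $ fst e + x $ snd e)" for e
  \<comment> \<open>Parallelogram law: the penalty of an arc splits into a part free of
    \<open>w\<close> and the squared distance of \<open>w\<close> from the midpoint.\<close>
  have quad: "c / 2 * ((norm (p - w))\<^sup>2 + (norm (q - w))\<^sup>2) =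
      c / 4 * (norm (p - q))\<^sup>2 + c * (norm (w - (1/2) *\<^sub>R (p + q)))\<^sup>2" for p q w :: "real^'p"
    by (simp add: power2_norm_eq_inner inner_diff_left inner_diff_right inner_add_left
        inner_add_right inner_commute field_simps)
  have "aug_lagrangian N f c x y (case_sum vb vt) \<le> aug_lagrangian N f c x m (case_sum vb vt)"
    using min by (auto simp: is_arg_min_linorder)
  then have "(\<Sum>e\<in>arcs N. c * (norm (y e - m e))\<^sup>2) \<le> (\<Sum>e\<in>arcs N. c * (norm (m e - m e))\<^sup>2)"
    unfolding aug_lagrangian_arcs lagrangian_antisym[OF anti] quad
    by (simp add: sum.distrib m_def)
  then have "(\<Sum>e\<in>arcs N. c * (norm (y e - m e))\<^sup>2) \<le> 0" by simp
  then have "(\<Sum>e\<in>arcs N. c * (norm (y e - m e))\<^sup>2) = 0"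
    using \<open>c > 0\<close> by (intro antisym) (simp_all add: sum_nonneg)
  then have "c * (norm (y e - m e))\<^sup>2 = 0"
    using e \<open>c > 0\<close> by (subst (asm) sum_nonneg_eq_0_iff) auto
  then show ?thesis using \<open>c > 0\<close> by (simp add: m_def)
qed

subsection \<open>Optimality conditions\<close>

text \<open>The second part says that \<open>-A\<^sup>Tv\<close> is a subgradient of \<open>total_cost f\<close> at \<open>x\<close>, for
  \<open>v = (vb, -vb)\<close>.\<close>

definition kkt :: "('n::finite \<Rightarrow> 'n set) \<Rightarrow> ('n \<Rightarrow> real^'p \<Rightarrow> real) \<Rightarrow> real^'p^'n
    \<Rightarrow> ('n \<times> 'n \<Rightarrow> real^'p::finite) \<Rightarrow> bool" where
  "kkt N f x vb \<longleftrightarrow> (\<forall>e\<in>arcs N. x $ fst e = x $ snd e) \<and>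
     (\<forall>y. total_cost f x \<le> total_cost f y + (\<Sum>e\<in>arcs N. vb e \<bullet> (y $ fst e - y $ snd e)))"

lemma dual_value_le: "dual_value N f v \<le> ereal (lagrangian N f x y v)"
  unfolding dual_value_def by (meson INF_lower2 INF_lower UNIV_I)

lemma lagrangian_feasible:
  "feasible N x y \<Longrightarrow> lagrangian N f x y v = total_cost f x"
  by (simp add: lagrangian_def feasible_def)

text \<open>A zero duality gap makes \<open>x\<close> a minimizer of the Lagrangian for the optimal
  multiplier, and by antisymmetry that Lagrangian does not see \<open>y\<close>.\<close>

lemma optimal_pair_imp_kkt:
  assumes "optimal_pair N f x y vb vt"
  shows "kkt N f x vb"
proof -
  have anti: "\<forall>e\<in>arcs N. vb e = - vt e" and feas: "feasible N x y"
    and dv: "dual_value N f (case_sum vb vt) = ereal (total_cost f x)"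
    using assms by (auto simp: optimal_pair_def primal_optimal_def)
  have "total_cost f x \<le> lagrangian N f x' y (case_sum vb vt)" for x'
    using dual_value_le[of N f "case_sum vb vt" x' y] dv by simp
  then show ?thesis
    using feas by (auto simp: kkt_def feasible_iff lagrangian_antisym[OF anti])
qed

text \<open>Evaluating the Lagrangian at the feasible point \<open>x\<close> bounds every dual value
  by \<open>total_cost f x\<close>. The subgradient part of \<open>kkt\<close> shows that
  \<open>vb\<close> attains this bound, and hence that no feasible point costs less. The auxiliary
  variable is the common value at the two endpoints.\<close>

lemma kkt_imp_optimal_pair:
  assumes "kkt N f x vb"
  shows "optimal_pair N f x (\<lambda>e. x $ fst e) vb (\<lambda>e. - vb e)"
proof -
  let ?v = "case_sum vb (\<lambda>e. - vb e)"
  have anti: "\<forall>e\<in>arcs N. vb e = - (- vb e)" by simp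
  have feas: "feasible N x (\<lambda>e. x $ fst e)"
    using assms by (auto simp: kkt_def feasible_iff)
  have low: "total_cost f x \<le> lagrangian N f x' y' ?v" for x' y'
    using assms by (simp only: lagrangian_antisym[OF anti] kkt_def)
  have weak: "dual_value N f w \<le> ereal (total_cost f x)" for w
    using dual_value_le[of N f w x "\<lambda>e. x $ fst e"] by (simp add: lagrangian_feasible[OF feas])
  have dv: "dual_value N f ?v = ereal (total_cost f x)"
  proof (rule antisym[OF weak])
    show "ereal (total_cost f x) \<le> dual_value N f ?v"
      unfolding dual_value_def using low by (intro INF_greatest) simp
  qed
  have "total_cost f x \<le> total_cost f x'" if "feasible N x' y'" for x' y'
    using low[of x' y'] lagrangian_feasible[OF that] by simp
  then show ?thesis
    using feas weak by (auto simp: optimal_pair_def primal_optimal_def dual_optimal_def dv)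
qed

text \<open>Fermat's rule for a convex, possibly nonsmooth \<open>F\<close> plus a function
  quadratic along the line: compare \<open>x\<close> with \<open>x + t *\<^sub>R d\<close>, bound
  \<open>F\<close> there by its chord, divide by \<open>t\<close> and let \<open>t\<close> tend to 0
  from the right. Here \<open>l\<close> is the derivative of \<open>\<phi>\<close> at
  \<open>x\<close> along \<open>d\<close>.\<close>

lemma convex_minimizer_subgradient:
  fixes F \<phi> :: "'a::real_vector \<Rightarrow> real"
  assumes "convex_on UNIV F"
    and quad: "\<And>t. \<phi> (x + t *\<^sub>R d) = \<phi> x + t * l + t\<^sup>2 * m"
    and min: "\<And>y. F x + \<phi> x \<le> F y + \<phi> y"
  shows "F x \<le> F (x + d) + l"
proof -
  have bound: "F x \<le> F (x + d) + l + t * m" if t: "0 < t" "t \<le> 1" for t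
  proof -
    have "F (x + t *\<^sub>R d) = F ((1 - t) *\<^sub>R x + t *\<^sub>R (x + d))"
      by (simp add: algebra_simps)
    also have "\<dots> \<le> (1 - t) * F x + t * F (x + d)"
      using convex_onD[OF assms(1), of t x "x + d"] t by simp
    finally have "t * F x \<le> t * (F (x + d) + l + t * m)"
      using min[of "x + t *\<^sub>R d"] quad[of t] by (simp add: algebra_simps power2_eq_square)
    then show ?thesis using t by simp
  qed
  have lim: "((\<lambda>t. F (x + d) + l + t * m) \<longlongrightarrow> F (x + d) + l + 0 * m) (at_right 0)"
    by (intro tendsto_intros)
  have "eventually (\<lambda>t. F x \<le> F (x + d) + l + t * m) (at_right 0)"
    using eventually_at_right_real[OF zero_less_one]
    by eventually_elim (use bound in auto)
  from tendsto_lowerbound[OF lim this] show ?thesis by simp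
qed

text \<open>Joins the node-wise minimizations into a single one. A total no larger than that at
  \<open>x\<close> forces each nonnegative gap \<open>h i (y $ i) - h i (x $ i)\<close> to vanish,
  after which uniqueness acts in every component.\<close>

lemma unique_arg_min_separable:
  fixes h :: "'n::finite \<Rightarrow> 'a \<Rightarrow> real"
  assumes "\<And>i. unique_arg_min (h i) (x $ i)"
  shows "unique_arg_min (\<lambda>y :: 'a^'n. (\<Sum>i\<in>UNIV. h i (y $ i)) + b) x"
proof -
  have le: "h i (x $ i) \<le> h i w" for i w
    using assms[of i] by (auto simp: unique_arg_min_def is_arg_min_linorder)
  have uniq: "w = x $ i" if "h i w \<le> h i (x $ i)" for i w
  proof -
    have "is_arg_min (h i) (\<lambda>_. True) w"
      using order_trans[OF that le] by (simp add: is_arg_min_linorder)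
    then show ?thesis using assms[of i] unfolding unique_arg_min_def by blast
  qed
  have "y = x" if min: "\<forall>y'. (\<Sum>i\<in>UNIV. h i (y $ i)) \<le> (\<Sum>i\<in>UNIV. h i (y' $ i))" for y :: "'a^'n"
  proof -
    have "(\<Sum>i\<in>UNIV. h i (y $ i)) \<le> (\<Sum>i\<in>UNIV. h i (x $ i))" using min by blast
    then have "(\<Sum>i\<in>UNIV. h i (y $ i) - h i (x $ i)) \<le> 0" by (simp add: sum_subtractf)
    moreover have "(\<Sum>i\<in>UNIV. h i (y $ i) - h i (x $ i)) \<ge> 0" by (simp add: sum_nonneg le)
    ultimately have "(\<Sum>i\<in>UNIV. h i (y $ i) - h i (x $ i)) = 0" by simp
    then have "\<forall>i. h i (y $ i) - h i (x $ i) = 0"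
      by (subst (asm) sum_nonneg_eq_0_iff) (auto simp: le)
    then show ?thesis by (simp add: vec_eq_iff uniq)
  qed
  moreover have "(\<Sum>i\<in>UNIV. h i (x $ i)) \<le> (\<Sum>i\<in>UNIV. h i (y $ i))" for y
    by (intro sum_mono le)
  ultimately show ?thesis
    unfolding unique_arg_min_def is_arg_min_linorder by auto
qed

subsection \<open>The iterations\<close>

text \<open>The two claims need a joint induction: antisymmetry at step \<open>k\<close> makes the
  next \<open>z\<close> the midpoint, and at the midpoint the two residuals of an arc are opposite,
  which preserves antisymmetry. The condition on \<open>E_u\<close> is the midpoint formula at step
  0.\<close>

lemma admm_multipliers:
  assumes "c > 0" "multiplier_steps N c s z vb vt" "z_steps N f c s z vb vt"
    "\<forall>e\<in>arcs N. vb 0 e = - vt 0 e"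
    "\<forall>e\<in>arcs N. block_mult E_u UNIV (\<lambda>i. s 0 $ i) e = 2 *\<^sub>R z 0 e"
  shows "\<forall>e\<in>arcs N. vb k e = - vt k e \<and> z k e = (1/2) *\<^sub>R (s k $ fst e + s k $ snd e)"
proof (induction k)
  case 0
  have "block_mult E_u UNIV (\<lambda>i. s 0 $ i) e = s 0 $ fst e + s 0 $ snd e" for e
    by (simp add: block_mult_def E_u_def A_s_def A_d_def matrix_vector_mult_add_rdistrib
        sum.distrib if_distrib[of "\<lambda>M. M *v _"] cong: if_cong)
  then show ?case using assms(4,5) by (simp del: scaleR_right_distrib)
next
  case (Suc k)
  have mid: "z (Suc k) e = (1/2) *\<^sub>R (s (Suc k) $ fst e + s (Suc k) $ snd e)" if "e \<in> arcs N" for e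
  proof (rule z_step_midpoint[OF assms(1) _ _ that])
    show "\<forall>e\<in>arcs N. vb k e = - vt k e" using Suc by blast
    show "is_arg_min (\<lambda>y. aug_lagrangian N f c (s (Suc k)) y (case_sum (vb k) (vt k)))
        (\<lambda>_. True) (z (Suc k))"
      using assms(3) by (simp add: z_steps_def)
  qed
  moreover have "vb (Suc k) e = - vt (Suc k) e" if "e \<in> arcs N" for e
  proof -
    have "vb (Suc k) e = vb k e + c *\<^sub>R (s (Suc k) $ fst e - z (Suc k) e)"
      "vt (Suc k) e = vt k e + c *\<^sub>R (s (Suc k) $ snd e - z (Suc k) e)"
      using assms(2) that by (cases e; fastforce simp: multiplier_steps_def)+
    moreover have "s (Suc k) $ fst e - z (Suc k) e = - (s (Suc k) $ snd e - z (Suc k) e)"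
      unfolding mid[OF that] by (simp add: vec_eq_iff field_simps)
    ultimately show ?thesis using Suc that by (simp del: minus_diff_eq)
  qed
  ultimately show ?case by blast
qed

section \<open>Sums over arcs, the map A^T, and the decentralized iterations as ADMM\<close>

lemma sum_arcs:
  fixes N :: "'n::finite \<Rightarrow> 'n set"
  shows "(\<Sum>e\<in>arcs N. g e) = (\<Sum>i\<in>UNIV. \<Sum>j\<in>N i. g (i, j))"
proof -
  have "arcs N = (SIGMA i:UNIV. N i)" by (auto simp: arcs_def)
  then show ?thesis by (simp add: sum.Sigma)
qed

text \<open>By symmetry of the graph, reversing arcs is an involution of
  \<open>arcs N\<close>.\<close>

lemma sum_arcs_swap:
  assumes "\<forall>i j. j \<in> N i \<longleftrightarrow> i \<in> N j"
  shows "(\<Sum>e\<in>arcs N. g (prod.swap e)) = (\<Sum>e\<in>arcs N. g e)"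
  using assms
  by (intro sum.reindex_bij_witness[of _ prod.swap prod.swap]) (auto simp: arcs_def)

lemma block_mult_transpose_A:
  fixes N :: "'n::finite \<Rightarrow> 'n set" and v :: "'n \<times> 'n + 'n \<times> 'n \<Rightarrow> real^'p::finite"
  shows "block_mult (block_transpose mat_A) (row_indices N) v i =
    (\<Sum>e\<in>arcs N. (if fst e = i then v (Inl e) else 0) + (if snd e = i then v (Inr e) else 0))"
proof -
  have "w v* (if b then mat 1 else 0) = (if b then w else 0)" for b and w :: "real^'p"
    by simp
  then show ?thesis
    by (simp add: block_mult_def sum_row_indices block_transpose_def mat_A_def A_s_def A_d_def)
qed

text \<open>Adjointness of \<open>mat_A\<close>: exchanging the sums over nodes and arcs leaves each
  arc with its two endpoints.\<close>

lemma sum_inner_transpose_A: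
  fixes N :: "'n::finite \<Rightarrow> 'n set" and v :: "'n \<times> 'n + 'n \<times> 'n \<Rightarrow> real^'p::finite"
  shows "(\<Sum>i\<in>UNIV. block_mult (block_transpose mat_A) (row_indices N) v i \<bullet> (x $ i)) =
    (\<Sum>e\<in>arcs N. v (Inl e) \<bullet> (x $ fst e) + v (Inr e) \<bullet> (x $ snd e))"
proof -
  have pick: "(if b then w else 0) \<bullet> y = (if b then w \<bullet> y else 0)" for b and w y :: "real^'p"
    by simp
  show ?thesis
    unfolding block_mult_transpose_A inner_sum_left inner_add_left pick
    by (subst sum.swap) (simp add: sum.distrib)
qed

lemma sum_arcs_from:
  fixes N :: "'n::finite \<Rightarrow> 'n set"
  shows "(\<Sum>e\<in>arcs N. if fst e = i then g e else 0) = (\<Sum>j\<in>N i. g (i, j))"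
proof -
  have "(\<Sum>e\<in>arcs N. if fst e = i then g e else 0) =
      (\<Sum>i'\<in>UNIV. if i' = i then \<Sum>j\<in>N i'. g (i', j) else 0)"
    unfolding sum_arcs by (intro sum.cong) auto
  then show ?thesis by simp
qed

lemma sum_arcs_to:
  fixes N :: "'n::finite \<Rightarrow> 'n set"
  assumes "\<forall>i j. j \<in> N i \<longleftrightarrow> i \<in> N j"
  shows "(\<Sum>e\<in>arcs N. if snd e = i then g e else 0) = (\<Sum>j\<in>N i. g (j, i))"
  using sum_arcs_swap[OF assms, where g = "\<lambda>e. if snd e = i then g e else 0"]
    sum_arcs_from[where N = N and i = i and g = "\<lambda>e. g (prod.swap e)"]
  by simp

text \<open>A^T v and the node multiplier receive the same increment in every step, so their
  agreement at step 0 persists. The augmented Lagrangian then splits into the node-wise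
  objectives.\<close>

lemma decentralized_imp_admm:
  fixes N :: "'n::finite \<Rightarrow> 'n set" and s :: "nat \<Rightarrow> real^'p::finite^'n"
  assumes sym: "\<forall>i j. j \<in> N i \<longleftrightarrow> i \<in> N j"
    and mid: "\<And>k e. e \<in> arcs N \<Longrightarrow> vb k e = - vt k e \<and> z k e = (1/2) *\<^sub>R (s k $ fst e + s k $ snd e)"
    and step: "\<And>k e. e \<in> arcs N \<Longrightarrow>
        vb (Suc k) e = vb k e + (c/2) *\<^sub>R (s (Suc k) $ fst e - s (Suc k) $ snd e)"
    and dec: "decentralized_iterations N f c s (\<lambda>k. node_multiplier N (vb k))"
    and red: "reduction_valid N (vb 0) (vt 0)"
  shows "admm_s_steps N f c s z vb vt"
proof -
  define q where "q k i = block_mult (block_transpose mat_A) (row_indices N) (case_sum (vb k) (vt k)) i"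
    for k i
  have q: "q k i = (\<Sum>e\<in>arcs N. if fst e = i then vb k e else 0) -
      (\<Sum>e\<in>arcs N. if snd e = i then vb k e else 0)" for k i
    unfolding q_def block_mult_transpose_A sum_subtractf[symmetric]
    using mid by (intro sum.cong) auto
  \<comment> \<open>An arc and its reverse receive opposite increments, and incoming arcs count
    negatively in \<open>q\<close>; so two contributions with factor \<open>c/2\<close> add up to
    \<open>c\<close>.\<close>
  have q_Suc: "q (Suc k) i = q k i + c *\<^sub>R (\<Sum>j\<in>N i. s (Suc k) $ i - s (Suc k) $ j)" for k i
  proof -
    define w where "w e = (c/2) *\<^sub>R (s (Suc k) $ fst e - s (Suc k) $ snd e)" for e
    have "vb (Suc k) (i, j) = vb k (i, j) + w (i, j)" "vb (Suc k) (j, i) = vb k (j, i) + w (j, i)"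
      if "j \<in> N i" for j
      using that sym by (simp_all add: step arcs_def w_def)
    then have "q (Suc k) i = q k i + ((\<Sum>j\<in>N i. w (i, j)) - (\<Sum>j\<in>N i. w (j, i)))"
      unfolding q sum_arcs_from sum_arcs_to[OF sym] by (simp add: sum.distrib)
    also have "(\<Sum>j\<in>N i. w (i, j)) - (\<Sum>j\<in>N i. w (j, i)) =
        (\<Sum>j\<in>N i. c *\<^sub>R (s (Suc k) $ i - s (Suc k) $ j))"
      unfolding sum_subtractf[symmetric]
      by (intro sum.cong) (auto simp: w_def vec_eq_iff field_simps)
    finally show ?thesis by (simp add: scaleR_sum_right)
  qed
  have q_node: "q k i = node_multiplier N (vb k) i" for k i
  proof (induction k)
    case 0
    then show ?case using red by (simp add: reduction_valid_def q_def)
  next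
    case (Suc k)
    then show ?case using dec q_Suc by (simp add: decentralized_iterations_def)
  qed
  have "unique_arg_min (\<lambda>x. aug_lagrangian N f c x (z k) (case_sum (vb k) (vt k))) (s (Suc k))" for k
  proof -
    define m where "m e = (1/2) *\<^sub>R (s k $ fst e + s k $ snd e)" for e
    have m_swap: "m (prod.swap e) = m e" for e
      by (simp add: m_def add.commute)
    define h where "h i x = f i x + node_multiplier N (vb k) i \<bullet> x
        + c * (\<Sum>j\<in>N i. (norm (x - (1/2) *\<^sub>R (s k $ i + s k $ j)))\<^sup>2)" for i x
    have "aug_lagrangian N f c x (z k) (case_sum (vb k) (vt k)) = (\<Sum>i\<in>UNIV. h i (x $ i)) + 0" for x
    proof -
      have lin: "(\<Sum>e\<in>arcs N. vb k e \<bullet> (x $ fst e - x $ snd e)) =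
          (\<Sum>i\<in>UNIV. node_multiplier N (vb k) i \<bullet> (x $ i))"
        unfolding q_node[symmetric] q_def sum_inner_transpose_A
        using mid by (intro sum.cong) (auto simp: inner_diff_right)
      \<comment> \<open>Since \<open>m\<close> is invariant under arc reversal, the two halves of
        the penalty agree; this turns the factor \<open>c / 2\<close> into the \<open>c\<close> of
        the node-wise objective.\<close>
      have "(\<Sum>e\<in>arcs N. (norm (x $ snd e - m e))\<^sup>2) = (\<Sum>e\<in>arcs N. (norm (x $ fst e - m e))\<^sup>2)"
        using sum_arcs_swap[OF sym, of "\<lambda>e. (norm (x $ snd e - m e))\<^sup>2"] by (simp add: m_swap)
      then have "(\<Sum>e\<in>arcs N. c / 2 * ((norm (x $ fst e - z k e))\<^sup>2 + (norm (x $ snd e - z k e))\<^sup>2)) =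
          c * (\<Sum>e\<in>arcs N. (norm (x $ fst e - m e))\<^sup>2)"
        using mid by (simp add: m_def[symmetric] sum_distrib_left[symmetric] sum_divide_distrib[symmetric]
            sum.distrib cong: sum.cong)
      also have "\<dots> = (\<Sum>i\<in>UNIV. c * (\<Sum>j\<in>N i. (norm (x $ i - m (i, j)))\<^sup>2))"
        by (simp add: sum_arcs sum_distrib_left)
      finally show ?thesis
        using mid lin unfolding aug_lagrangian_arcs
        by (subst lagrangian_antisym) (auto simp: h_def total_cost_def sum.distrib m_def)
    qed
    moreover have "unique_arg_min (h i) (s (Suc k) $ i)" for i
      using dec unfolding decentralized_iterations_def h_def[abs_def] by blast
    ultimately show ?thesis
      using unique_arg_min_separable[of h "s (Suc k)" 0] by presburger
  qed
  then show ?thesis by (simp add: admm_s_steps_def)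
qed

text \<open>The objective apart from the cost is quadratic along lines, and its derivative at the
  minimizer can be written with the updated \<open>vb'\<close> and \<open>w'\<close>. The old
  multiplier is absorbed, which is the implicit form that the descent estimate needs.\<close>

lemma s_step_subgradient:
  fixes N :: "'n::finite \<Rightarrow> 'n set" and x :: "real^'p::finite^'n"
  assumes conv: "convex_on UNIV (total_cost f)"
    and anti: "\<forall>e\<in>arcs N. vb e = - vt e"
    and min: "is_arg_min (\<lambda>x. aug_lagrangian N f c x w (case_sum vb vt)) (\<lambda>_. True) x"
    and w': "\<And>e. e \<in> arcs N \<Longrightarrow> w' e = (1/2) *\<^sub>R (x $ fst e + x $ snd e)"
    and vb': "\<And>e. e \<in> arcs N \<Longrightarrow> vb' e = vb e + (c/2) *\<^sub>R (x $ fst e - x $ snd e)"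
  shows "total_cost f x \<le> total_cost f (x + d) +
    (\<Sum>e\<in>arcs N. vb' e \<bullet> (d $ fst e - d $ snd e) + c * ((w' e - w e) \<bullet> (d $ fst e + d $ snd e)))"
proof (rule convex_minimizer_subgradient[OF conv])
  define \<phi> where "\<phi> x = (\<Sum>e\<in>arcs N. vb e \<bullet> (x $ fst e - x $ snd e)
     + c / 2 * ((norm (x $ fst e - w e))\<^sup>2 + (norm (x $ snd e - w e))\<^sup>2))" for x :: "real^'p^'n"
  show "total_cost f x + \<phi> x \<le> total_cost f y + \<phi> y" for y
  proof -
    have "aug_lagrangian N f c x w (case_sum vb vt) = total_cost f x + \<phi> x" for x
      by (simp add: aug_lagrangian_arcs lagrangian_antisym[OF anti] \<phi>_def sum.distrib)
    then show ?thesis using min by (simp add: is_arg_min_linorder)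
  qed
  \<comment> \<open>The coefficient of \<open>t\<close> is \<open>(l + c *\<^sub>R (a - y))
    \<bullet> p + (c *\<^sub>R (b - y) - l) \<bullet> r\<close>; regrouping by \<open>p - r\<close>
    and \<open>p + r\<close> brings out the multiplier update and the midpoint.\<close>
  have arc: "l \<bullet> ((a + t *\<^sub>R p) - (b + t *\<^sub>R r)) + c / 2 * ((norm (a + t *\<^sub>R p - y))\<^sup>2 + (norm (b + t *\<^sub>R r - y))\<^sup>2) =
     (l \<bullet> (a - b) + c / 2 * ((norm (a - y))\<^sup>2 + (norm (b - y))\<^sup>2)) +
     t * ((l + (c/2) *\<^sub>R (a - b)) \<bullet> (p - r) + c * (((1/2) *\<^sub>R (a + b) - y) \<bullet> (p + r))) +
     t\<^sup>2 * (c / 2 * ((norm p)\<^sup>2 + (norm r)\<^sup>2))" for l a b p r y :: "real^'p" and t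
  proof -
    have norm_line: "(norm (a + t *\<^sub>R p - y))\<^sup>2 = (norm (a - y))\<^sup>2 + 2 * t * ((a - y) \<bullet> p) + t\<^sup>2 * (norm p)\<^sup>2"
      for a p :: "real^'p"
    proof -
      have "(norm (u + t *\<^sub>R p))\<^sup>2 = (norm u)\<^sup>2 + 2 * t * (u \<bullet> p) + t\<^sup>2 * (norm p)\<^sup>2" for u
        unfolding power2_norm_eq_inner
        by (simp add: inner_add_left inner_add_right inner_commute power2_eq_square)
      moreover have "a + t *\<^sub>R p - y = (a - y) + t *\<^sub>R p" by simp
      ultimately show ?thesis by (simp only:)
    qed
    show ?thesis
      unfolding norm_line
      by (simp add: inner_diff_left inner_diff_right inner_add_left inner_add_right field_simps)
  qed
  show "\<phi> (x + t *\<^sub>R d) = \<phi> x + t * (\<Sum>e\<in>arcs N. vb' e \<bullet> (d $ fst e - d $ snd e)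
       + c * ((w' e - w e) \<bullet> (d $ fst e + d $ snd e)))
     + t\<^sup>2 * (\<Sum>e\<in>arcs N. c / 2 * ((norm (d $ fst e))\<^sup>2 + (norm (d $ snd e))\<^sup>2))" for t
    unfolding \<phi>_def sum_distrib_left sum.distrib[symmetric]
    by (intro sum.cong refl) (simp only: vector_add_component vector_scaleR_component w' vb' arc)
qed

subsection \<open>Convergence\<close>

text \<open>The endpoints enter only through difference and sum: \<open>c *\<^sub>R (a - b)\<close>
  is twice the increment of \<open>l\<close>, and \<open>(x - a) + (x - b)\<close> is twice
  \<open>x - w'\<close>. Each resulting inner product is a three-point identity for squared
  distances.\<close>

lemma arc_identity:
  fixes l l' w w' \<mu> a b x :: "'a::real_inner"
  assumes "c > 0" and l': "l' = l + (c/2) *\<^sub>R (a - b)" and w': "w' = (1/2) *\<^sub>R (a + b)"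
  shows "c * (l' \<bullet> ((x - a) - (x - b)) + c * ((w' - w) \<bullet> ((x - a) + (x - b))) + \<mu> \<bullet> (a - b)) =
    ((norm (l - \<mu>))\<^sup>2 + c\<^sup>2 * (norm (w - x))\<^sup>2) - ((norm (l' - \<mu>))\<^sup>2 + c\<^sup>2 * (norm (w' - x))\<^sup>2)
    - ((norm (l' - l))\<^sup>2 + c\<^sup>2 * (norm (w' - w))\<^sup>2)"
proof -
  have three_points: "(norm (u - v))\<^sup>2 - (norm (u' - v))\<^sup>2 - (norm (u' - u))\<^sup>2 = 2 * ((u' - u) \<bullet> (v - u'))"
    for u u' v :: 'a
    unfolding power2_norm_eq_inner by (simp add: inner_diff_left inner_diff_right inner_commute)
  have ab: "c *\<^sub>R (a - b) = 2 *\<^sub>R (l' - l)" unfolding l' by simp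
  have xab: "(x - a) + (x - b) = 2 *\<^sub>R (x - w')" unfolding w' by (simp add: algebra_simps scaleR_2)
  have "c * (l' \<bullet> ((x - a) - (x - b)) + c * ((w' - w) \<bullet> ((x - a) + (x - b))) + \<mu> \<bullet> (a - b)) =
      (\<mu> - l') \<bullet> (c *\<^sub>R (a - b)) + c\<^sup>2 * ((w' - w) \<bullet> (2 *\<^sub>R (x - w')))"
    unfolding xab by (simp add: inner_diff_left inner_diff_right algebra_simps power2_eq_square)
  also have "\<dots> = 2 * ((l' - l) \<bullet> (\<mu> - l')) + c\<^sup>2 * (2 * ((w' - w) \<bullet> (x - w')))"
    unfolding ab by (simp add: inner_commute)
  also have "\<dots> = ((norm (l - \<mu>))\<^sup>2 - (norm (l' - \<mu>))\<^sup>2 - (norm (l' - l))\<^sup>2)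
      + c\<^sup>2 * ((norm (w - x))\<^sup>2 - (norm (w' - x))\<^sup>2 - (norm (w' - w))\<^sup>2)"
    unfolding three_points ..
  finally show ?thesis by (simp add: algebra_simps)
qed

text \<open>What the descent argument uses of the ADMM: \<open>lam\<close> stands for
  \<open>vb\<close>, with \<open>vt = - vb\<close> eliminated, and the minimization over
  \<open>s\<close> survives only as its subgradient inequality.\<close>

locale edge_iterates =
  fixes N :: "'n::finite \<Rightarrow> 'n set" and f :: "'n \<Rightarrow> real^'p::finite \<Rightarrow> real" and c :: real
    and s :: "nat \<Rightarrow> real^'p^'n" and z lam :: "nat \<Rightarrow> 'n \<times> 'n \<Rightarrow> real^'p"
  assumes c_pos: "c > 0"
    and cost_continuous: "continuous_on UNIV (total_cost f)"
    and midpoint: "\<And>k e. e \<in> arcs N \<Longrightarrow> z k e = (1/2) *\<^sub>R (s k $ fst e + s k $ snd e)"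
    and lam_step: "\<And>k e. e \<in> arcs N \<Longrightarrow>
      lam (Suc k) e = lam k e + (c/2) *\<^sub>R (s (Suc k) $ fst e - s (Suc k) $ snd e)"
    and subgradient: "\<And>k d. total_cost f (s (Suc k)) \<le> total_cost f (s (Suc k) + d) +
      (\<Sum>e\<in>arcs N. lam (Suc k) e \<bullet> (d $ fst e - d $ snd e)
        + c * ((z (Suc k) e - z k e) \<bullet> (d $ fst e + d $ snd e)))"
begin

text \<open>At a \<open>kkt\<close> point both endpoints of an arc carry the same value, so reading
  \<open>x\<close> at \<open>fst e\<close> rather than \<open>snd e\<close> is an arbitrary
  choice.\<close>

definition lyapunov :: "('n \<times> 'n \<Rightarrow> real^'p) \<Rightarrow> real^'p^'n \<Rightarrow> nat \<Rightarrow> real" where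
  "lyapunov \<mu> x k =
    (\<Sum>e\<in>arcs N. (norm (lam k e - \<mu> e))\<^sup>2 + c\<^sup>2 * (norm (z k e - x $ fst e))\<^sup>2)"

definition increment :: "nat \<Rightarrow> real" where
  "increment k = (\<Sum>e\<in>arcs N. (norm (lam (Suc k) e - lam k e))\<^sup>2 + c\<^sup>2 * (norm (z (Suc k) e - z k e))\<^sup>2)"

lemma lyapunov_nonneg: "lyapunov \<mu> x k \<ge> 0"
  by (simp add: lyapunov_def sum_nonneg)

lemma increment_nonneg: "increment k \<ge> 0"
  by (simp add: increment_def sum_nonneg)

lemma arc_le_lyapunov:
  assumes "e \<in> arcs N"
  shows "norm (lam k e - \<mu> e) \<le> sqrt (lyapunov \<mu> x k)"
    and "c * norm (z k e - x $ fst e) \<le> sqrt (lyapunov \<mu> x k)"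
proof -
  have "(norm (lam k e - \<mu> e))\<^sup>2 + c\<^sup>2 * (norm (z k e - x $ fst e))\<^sup>2 \<le> lyapunov \<mu> x k"
    unfolding lyapunov_def using assms by (intro member_le_sum) simp_all
  moreover have "0 \<le> (norm (lam k e - \<mu> e))\<^sup>2" "0 \<le> c\<^sup>2 * (norm (z k e - x $ fst e))\<^sup>2" by simp_all
  ultimately have "(norm (lam k e - \<mu> e))\<^sup>2 \<le> lyapunov \<mu> x k"
    "(c * norm (z k e - x $ fst e))\<^sup>2 \<le> lyapunov \<mu> x k"
    unfolding power_mult_distrib by linarith+
  then show "norm (lam k e - \<mu> e) \<le> sqrt (lyapunov \<mu> x k)"
    "c * norm (z k e - x $ fst e) \<le> sqrt (lyapunov \<mu> x k)"
    by (simp_all add: real_le_rsqrt)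
qed

lemma arc_le_increment:
  assumes "e \<in> arcs N"
  shows "norm (lam (Suc k) e - lam k e) \<le> sqrt (increment k)"
    and "c * norm (z (Suc k) e - z k e) \<le> sqrt (increment k)"
proof -
  have "(norm (lam (Suc k) e - lam k e))\<^sup>2 + c\<^sup>2 * (norm (z (Suc k) e - z k e))\<^sup>2 \<le> increment k"
    unfolding increment_def using assms by (intro member_le_sum) simp_all
  moreover have "0 \<le> (norm (lam (Suc k) e - lam k e))\<^sup>2" "0 \<le> c\<^sup>2 * (norm (z (Suc k) e - z k e))\<^sup>2"
    by simp_all
  ultimately have "(norm (lam (Suc k) e - lam k e))\<^sup>2 \<le> increment k"
    "(c * norm (z (Suc k) e - z k e))\<^sup>2 \<le> increment k"
    unfolding power_mult_distrib by linarith+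
  then show "norm (lam (Suc k) e - lam k e) \<le> sqrt (increment k)"
    "c * norm (z (Suc k) e - z k e) \<le> sqrt (increment k)"
    by (simp_all add: real_le_rsqrt)
qed

text \<open>Two subgradient inequalities, at \<open>s (Suc k)\<close> tested in \<open>x\<close> and
  at \<open>x\<close> tested in \<open>s (Suc k)\<close>, add up to one in which the costs cancel;
  \<open>arc_identity\<close> evaluates it arc by arc.\<close>

lemma lyapunov_decrease:
  assumes "kkt N f x \<mu>"
  shows "lyapunov \<mu> x (Suc k) + increment k \<le> lyapunov \<mu> x k"
proof -
  let ?s = "s (Suc k)"
  have "total_cost f ?s \<le> total_cost f x + (\<Sum>e\<in>arcs N. lam (Suc k) e \<bullet> ((x - ?s) $ fst e - (x - ?s) $ snd e)
        + c * ((z (Suc k) e - z k e) \<bullet> ((x - ?s) $ fst e + (x - ?s) $ snd e)))"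
    using subgradient[of k "x - ?s"] by simp
  moreover have "total_cost f x \<le> total_cost f ?s + (\<Sum>e\<in>arcs N. \<mu> e \<bullet> (?s $ fst e - ?s $ snd e))"
    using assms by (simp add: kkt_def)
  ultimately have "0 \<le> c * (\<Sum>e\<in>arcs N. lam (Suc k) e \<bullet> ((x - ?s) $ fst e - (x - ?s) $ snd e)
        + c * ((z (Suc k) e - z k e) \<bullet> ((x - ?s) $ fst e + (x - ?s) $ snd e))
        + \<mu> e \<bullet> (?s $ fst e - ?s $ snd e))"
    using c_pos by (simp add: sum.distrib)
  also have "\<dots> = (\<Sum>e\<in>arcs N.
      ((norm (lam k e - \<mu> e))\<^sup>2 + c\<^sup>2 * (norm (z k e - x $ fst e))\<^sup>2)
      - ((norm (lam (Suc k) e - \<mu> e))\<^sup>2 + c\<^sup>2 * (norm (z (Suc k) e - x $ fst e))\<^sup>2)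
      - ((norm (lam (Suc k) e - lam k e))\<^sup>2 + c\<^sup>2 * (norm (z (Suc k) e - z k e))\<^sup>2))"
    unfolding sum_distrib_left
  proof (intro sum.cong refl)
    fix e assume e: "e \<in> arcs N"
    have "x $ snd e = x $ fst e" using assms e by (simp add: kkt_def)
    then show "c * (lam (Suc k) e \<bullet> ((x - ?s) $ fst e - (x - ?s) $ snd e)
        + c * ((z (Suc k) e - z k e) \<bullet> ((x - ?s) $ fst e + (x - ?s) $ snd e))
        + \<mu> e \<bullet> (?s $ fst e - ?s $ snd e)) =
      ((norm (lam k e - \<mu> e))\<^sup>2 + c\<^sup>2 * (norm (z k e - x $ fst e))\<^sup>2)
      - ((norm (lam (Suc k) e - \<mu> e))\<^sup>2 + c\<^sup>2 * (norm (z (Suc k) e - x $ fst e))\<^sup>2)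
      - ((norm (lam (Suc k) e - lam k e))\<^sup>2 + c\<^sup>2 * (norm (z (Suc k) e - z k e))\<^sup>2)"
      using arc_identity[OF c_pos lam_step[OF e] midpoint[OF e]]
      by (simp only: vector_minus_component)
  qed
  also have "\<dots> = lyapunov \<mu> x k - lyapunov \<mu> x (Suc k) - increment k"
    unfolding lyapunov_def increment_def sum_subtractf ..
  finally show ?thesis by simp
qed

lemma lyapunov_decseq:
  assumes "kkt N f x \<mu>"
  shows "decseq (lyapunov \<mu> x)"
  using lyapunov_decrease[OF assms] increment_nonneg
  by (intro decseq_SucI) (meson add_increasing2 dual_order.trans le_add_same_cancel1)

lemma lyapunov_convergent:
  assumes "kkt N f x \<mu>"
  shows "convergent (lyapunov \<mu> x)"
  using decseq_convergent[OF lyapunov_decseq[OF assms], of 0] lyapunov_nonneg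
  by (metis convergentI)

text \<open>The increments lie between 0 and the consecutive differences of a convergent
  sequence.\<close>

lemma increment_tendsto_0:
  assumes "kkt N f x \<mu>"
  shows "increment \<longlonglongrightarrow> 0"
proof -
  obtain l where l: "lyapunov \<mu> x \<longlonglongrightarrow> l"
    using lyapunov_convergent[OF assms] by (auto simp: convergent_def)
  have "(\<lambda>k. lyapunov \<mu> x k - lyapunov \<mu> x (Suc k)) \<longlonglongrightarrow> l - l"
    by (intro tendsto_diff l LIMSEQ_Suc)
  then show ?thesis
    using lyapunov_decrease[OF assms] increment_nonneg
    by (intro tendsto_sandwich[where f = "\<lambda>_. 0" and g = increment
          and h = "\<lambda>k. lyapunov \<mu> x k - lyapunov \<mu> x (Suc k)"])
      (auto simp: algebra_simps)
qed

lemma lam_increment_tendsto_0: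
  assumes "increment \<longlonglongrightarrow> 0" "e \<in> arcs N"
  shows "(\<lambda>k. lam (Suc k) e - lam k e) \<longlonglongrightarrow> 0"
proof (rule Lim_null_comparison)
  show "(\<lambda>k. sqrt (increment k)) \<longlonglongrightarrow> 0" using tendsto_real_sqrt[OF assms(1)] by simp
qed (use arc_le_increment(1)[OF assms(2)] in simp)

lemma z_increment_tendsto_0:
  assumes "increment \<longlonglongrightarrow> 0" "e \<in> arcs N"
  shows "(\<lambda>k. z (Suc k) e - z k e) \<longlonglongrightarrow> 0"
proof (rule Lim_null_comparison)
  show "(\<lambda>k. (1 / c) * sqrt (increment k)) \<longlonglongrightarrow> 0"
    using tendsto_mult_left[OF tendsto_real_sqrt[OF assms(1)], of "1/c"] by simp
qed (use arc_le_increment(2)[OF assms(2)] c_pos in \<open>simp add: field_simps\<close>)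

text \<open>The endpoints are \<open>z\<close> plus or minus half their difference, and by the
  multiplier update this half is \<open>1 / c\<close> times a vanishing increment of
  \<open>lam\<close>. The subsequence form serves the cluster point and, with the identity for
  \<open>r\<close>, the full sequence.\<close>

lemma endpoints_tendsto:
  assumes "increment \<longlonglongrightarrow> 0" "e \<in> arcs N" "strict_mono r" "(\<lambda>m. z (Suc (r m)) e) \<longlonglongrightarrow> w"
  shows "(\<lambda>m. s (Suc (r m)) $ fst e) \<longlonglongrightarrow> w" and "(\<lambda>m. s (Suc (r m)) $ snd e) \<longlonglongrightarrow> w"
proof -
  have half: "(1 / c) *\<^sub>R (lam (Suc k) e - lam k e) = (1/2) *\<^sub>R (s (Suc k) $ fst e - s (Suc k) $ snd e)" for k
    using c_pos by (simp add: lam_step[OF assms(2)])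
  have "s (Suc k) $ fst e = z (Suc k) e + (1 / c) *\<^sub>R (lam (Suc k) e - lam k e)"
    "s (Suc k) $ snd e = z (Suc k) e - (1 / c) *\<^sub>R (lam (Suc k) e - lam k e)" for k
    unfolding half midpoint[OF assms(2)] by (simp_all add: vec_eq_iff field_simps)
  moreover have "(\<lambda>m. lam (Suc (r m)) e - lam (r m) e) \<longlonglongrightarrow> 0"
    using LIMSEQ_subseq_LIMSEQ[OF lam_increment_tendsto_0[OF assms(1,2)] assms(3)] by (simp add: o_def)
  from tendsto_scaleR[OF tendsto_const[of "1/c"] this]
  have "(\<lambda>m. (1 / c) *\<^sub>R (lam (Suc (r m)) e - lam (r m) e)) \<longlonglongrightarrow> 0" by simp
  from tendsto_add[OF assms(4) this] tendsto_diff[OF assms(4) this]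
  show "(\<lambda>m. s (Suc (r m)) $ fst e) \<longlonglongrightarrow> w" "(\<lambda>m. s (Suc (r m)) $ snd e) \<longlonglongrightarrow> w"
    unfolding calculation by simp_all
qed

text \<open>Bolzano-Weierstrass, with bounds from the initial value of the Lyapunov function. The
  indices \<open>Suc (r m)\<close> match the subgradient inequality, which is available from step 1
  on.\<close>

lemma cluster_point:
  assumes "kkt N f x \<mu>"
  obtains r \<mu>' y where "strict_mono r"
    and "\<And>e. e \<in> arcs N \<Longrightarrow> (\<lambda>m. lam (Suc (r m)) e) \<longlonglongrightarrow> \<mu>' e"
    and "\<And>e. e \<in> arcs N \<Longrightarrow> (\<lambda>m. z (Suc (r m)) e) \<longlonglongrightarrow> y e"
proof -
  \<comment> \<open>Arc functions are packed into Euclidean vectors indexed by all pairs; off the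
    arcs nothing bounds the iterates, so the entries there are set to 0.\<close>
  define S where "S k = ((\<chi> e. if e \<in> arcs N then lam (Suc k) e else 0) :: real^'p^('n \<times> 'n),
      (\<chi> e. if e \<in> arcs N then z (Suc k) e else 0) :: real^'p^('n \<times> 'n))" for k
  define b where "b = sqrt (lyapunov \<mu> x 0)"
  have b: "sqrt (lyapunov \<mu> x k) \<le> b" for k
    using lyapunov_decseq[OF assms] by (simp add: b_def decseq_def)
  have "norm (lam (Suc k) e) \<le> norm (\<mu> e) + b" if "e \<in> arcs N" for k e
    using arc_le_lyapunov(1)[OF that, of "Suc k" \<mu> x] b[of "Suc k"]
      norm_triangle_ineq[of "lam (Suc k) e - \<mu> e" "\<mu> e"] by simp
  moreover have "norm (z (Suc k) e) \<le> norm (x $ fst e) + b / c" if "e \<in> arcs N" for k e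
  proof -
    have "norm (z (Suc k) e - x $ fst e) \<le> b / c"
      using arc_le_lyapunov(2)[OF that, of "Suc k" x \<mu>] b[of "Suc k"] c_pos
      by (simp add: field_simps)
    then show ?thesis
      using norm_triangle_ineq[of "z (Suc k) e - x $ fst e" "x $ fst e"] by simp
  qed
  moreover have "b \<ge> 0" by (simp add: b_def lyapunov_nonneg)
  ultimately have "norm (fst (S k) $ e) \<le> norm (\<mu> e) + b"
    "norm (snd (S k) $ e) \<le> norm (x $ fst e) + b / c" for k e
    using c_pos by (auto simp: S_def)
  then have "(\<Sum>e\<in>UNIV. norm (fst (S k) $ e)) \<le> (\<Sum>e\<in>UNIV. norm (\<mu> e) + b)"
    "(\<Sum>e\<in>UNIV. norm (snd (S k) $ e)) \<le> (\<Sum>e\<in>(UNIV :: ('n \<times> 'n) set). norm (x $ fst e) + b / c)" for k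
    by (intro sum_mono; blast)+
  moreover have "norm v \<le> (\<Sum>e\<in>UNIV. norm (v $ e))" for v :: "real^'p^('n \<times> 'n)"
    unfolding norm_vec_def[of v] by (rule L2_set_le_sum) simp
  ultimately have "norm (fst (S k)) \<le> (\<Sum>e\<in>UNIV. norm (\<mu> e) + b)"
    "norm (snd (S k)) \<le> (\<Sum>e\<in>(UNIV :: ('n \<times> 'n) set). norm (x $ fst e) + b / c)" for k
    using order_trans by blast+
  then have "norm (S k) \<le> (\<Sum>e\<in>UNIV. norm (\<mu> e) + b) + (\<Sum>e\<in>(UNIV :: ('n \<times> 'n) set). norm (x $ fst e) + b / c)" for k
    using norm_Pair_le[of "fst (S k)" "snd (S k)"] unfolding prod.collapse
    by (meson add_mono order_trans)
  then have "bounded (range S)" by (auto simp: bounded_iff)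
  then obtain l r where r: "strict_mono r" and "(S \<circ> r) \<longlonglongrightarrow> l"
    using bounded_imp_convergent_subsequence by blast
  then have lim: "(\<lambda>m. fst (S (r m)) $ e) \<longlonglongrightarrow> fst l $ e" "(\<lambda>m. snd (S (r m)) $ e) \<longlonglongrightarrow> snd l $ e" for e
    by (auto simp: o_def intro!: tendsto_vec_nth tendsto_fst tendsto_snd)
  show ?thesis
  proof (rule that[OF r])
    fix e assume "e \<in> arcs N"
    then show "(\<lambda>m. lam (Suc (r m)) e) \<longlonglongrightarrow> fst l $ e" "(\<lambda>m. z (Suc (r m)) e) \<longlonglongrightarrow> snd l $ e"
      using lim[of e] by (simp_all add: S_def)
  qed
qed

lemma converges:
  assumes opt: "kkt N f x \<mu>" and nbr: "\<And>i. N i \<noteq> {}"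
  shows "\<exists>x' \<mu>'. kkt N f x' \<mu>' \<and> s \<longlonglongrightarrow> x' \<and> (\<forall>e\<in>arcs N. (\<lambda>k. lam k e) \<longlonglongrightarrow> \<mu>' e)"
proof -
  note inc = increment_tendsto_0[OF opt]
  obtain r \<mu>' y where r: "strict_mono r"
    and lam_lim: "\<And>e. e \<in> arcs N \<Longrightarrow> (\<lambda>m. lam (Suc (r m)) e) \<longlonglongrightarrow> \<mu>' e"
    and z_lim: "\<And>e. e \<in> arcs N \<Longrightarrow> (\<lambda>m. z (Suc (r m)) e) \<longlonglongrightarrow> y e"
    using cluster_point[OF opt] by blast
  have "\<forall>i. \<exists>j. (i, j) \<in> arcs N" using nbr by (auto simp: arcs_def)
  \<comment> \<open>The limit at a node is read off from one chosen outgoing arc. Since both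
    endpoints of an arc inherit the limit of \<open>z\<close> on it, the choice turns out to be
    immaterial.\<close>
  then obtain g where g: "\<And>i. (i, g i) \<in> arcs N" by metis
  define x' where "x' = (\<chi> i. y (i, g i))"
  have "(\<lambda>m. s (Suc (r m)) $ i) \<longlonglongrightarrow> x' $ i" for i
    using endpoints_tendsto(1)[OF inc g r z_lim[OF g]] by (simp add: x'_def)
  then have s_lim: "(\<lambda>m. s (Suc (r m))) \<longlonglongrightarrow> x'" by (rule vec_tendstoI)
  have y: "y e = x' $ fst e" "y e = x' $ snd e" if "e \<in> arcs N" for e
    using endpoints_tendsto[OF inc that r z_lim[OF that]] tendsto_vec_nth[OF s_lim] LIMSEQ_unique
    by blast+
  have "total_cost f x' \<le> total_cost f u + (\<Sum>e\<in>arcs N. \<mu>' e \<bullet> (u $ fst e - u $ snd e))" for u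
  proof -
    \<comment> \<open>This direction keeps the test point \<open>s (Suc (r m)) + d m\<close> at the
      fixed \<open>u\<close> while \<open>m\<close> grows.\<close>
    define d where "d m = u - s (Suc (r m))" for m
    have d_lim: "d \<longlonglongrightarrow> u - x'" unfolding d_def by (intro tendsto_intros s_lim)
    have z_inc: "(\<lambda>m. z (Suc (r m)) e - z (r m) e) \<longlonglongrightarrow> 0" if "e \<in> arcs N" for e
      using LIMSEQ_subseq_LIMSEQ[OF z_increment_tendsto_0[OF inc that] r] by (simp add: o_def)
    \<comment> \<open>The factor \<open>0\<close> is the limit of the increments of
      \<open>z\<close>; with it the penalty contribution leaves the inequality.\<close>
    have "total_cost f x' \<le> total_cost f u +
        (\<Sum>e\<in>arcs N. \<mu>' e \<bullet> ((u - x') $ fst e - (u - x') $ snd e)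
          + c * (0 \<bullet> ((u - x') $ fst e + (u - x') $ snd e)))"
    proof (rule LIMSEQ_le)
      show "(\<lambda>m. total_cost f (s (Suc (r m)))) \<longlonglongrightarrow> total_cost f x'"
        using cost_continuous s_lim by (rule continuous_on_tendsto_compose) auto
      show "(\<lambda>m. total_cost f u + (\<Sum>e\<in>arcs N. lam (Suc (r m)) e \<bullet> (d m $ fst e - d m $ snd e)
          + c * ((z (Suc (r m)) e - z (r m) e) \<bullet> (d m $ fst e + d m $ snd e)))) \<longlonglongrightarrow> total_cost f u +
        (\<Sum>e\<in>arcs N. \<mu>' e \<bullet> ((u - x') $ fst e - (u - x') $ snd e)
          + c * (0 \<bullet> ((u - x') $ fst e + (u - x') $ snd e)))"
        by (intro tendsto_intros lam_lim z_inc d_lim)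
      show "\<exists>M. \<forall>m\<ge>M. total_cost f (s (Suc (r m))) \<le> total_cost f u +
          (\<Sum>e\<in>arcs N. lam (Suc (r m)) e \<bullet> (d m $ fst e - d m $ snd e)
          + c * ((z (Suc (r m)) e - z (r m) e) \<bullet> (d m $ fst e + d m $ snd e)))"
      proof (intro exI allI impI)
        fix m
        have "s (Suc (r m)) + d m = u" by (simp add: d_def)
        then show "total_cost f (s (Suc (r m))) \<le> total_cost f u +
            (\<Sum>e\<in>arcs N. lam (Suc (r m)) e \<bullet> (d m $ fst e - d m $ snd e)
            + c * ((z (Suc (r m)) e - z (r m) e) \<bullet> (d m $ fst e + d m $ snd e)))"
          using subgradient[of "r m" "d m"] by simp
      qed
    qed
    also have "(\<Sum>e\<in>arcs N. \<mu>' e \<bullet> ((u - x') $ fst e - (u - x') $ snd e)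
          + c * (0 \<bullet> ((u - x') $ fst e + (u - x') $ snd e))) =
        (\<Sum>e\<in>arcs N. \<mu>' e \<bullet> (u $ fst e - u $ snd e))"
      using y by (intro sum.cong) (auto simp: algebra_simps)
    finally show ?thesis .
  qed
  then have kkt': "kkt N f x' \<mu>'" using y by (auto simp: kkt_def)
  have "(\<lambda>m. lyapunov \<mu>' x' (Suc (r m))) \<longlonglongrightarrow>
      (\<Sum>e\<in>arcs N. (norm (\<mu>' e - \<mu>' e))\<^sup>2 + c\<^sup>2 * (norm (y e - x' $ fst e))\<^sup>2)"
    unfolding lyapunov_def by (intro tendsto_intros lam_lim z_lim)
  then have sub: "(\<lambda>m. lyapunov \<mu>' x' (Suc (r m))) \<longlonglongrightarrow> 0" by (simp add: y(1)[symmetric])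
  obtain l where l: "lyapunov \<mu>' x' \<longlonglongrightarrow> l"
    using lyapunov_convergent[OF kkt'] by (auto simp: convergent_def)
  have "(\<lambda>m. lyapunov \<mu>' x' (Suc (r m))) \<longlonglongrightarrow> l"
    using LIMSEQ_subseq_LIMSEQ[OF LIMSEQ_Suc[OF l] r] by (simp add: o_def)
  with l sub have "lyapunov \<mu>' x' \<longlonglongrightarrow> 0" using LIMSEQ_unique by blast
  from tendsto_real_sqrt[OF this]
  have lyap: "(\<lambda>k. sqrt (lyapunov \<mu>' x' k)) \<longlonglongrightarrow> 0" by simp
  have lam_conv: "(\<lambda>k. lam k e) \<longlonglongrightarrow> \<mu>' e" if "e \<in> arcs N" for e
  proof -
    have "(\<lambda>k. lam k e - \<mu>' e) \<longlonglongrightarrow> 0"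
      using lyap by (rule Lim_null_comparison[rotated]) (use arc_le_lyapunov(1)[OF that] in simp)
    then show ?thesis by (simp add: LIM_zero_iff)
  qed
  have z_conv: "(\<lambda>k. z k e) \<longlonglongrightarrow> x' $ fst e" if "e \<in> arcs N" for e
  proof -
    have "(\<lambda>k. (1 / c) * sqrt (lyapunov \<mu>' x' k)) \<longlonglongrightarrow> 0"
      using tendsto_mult_left[OF lyap, of "1 / c"] by simp
    then have "(\<lambda>k. z k e - x' $ fst e) \<longlonglongrightarrow> 0"
      by (rule Lim_null_comparison[rotated])
        (use arc_le_lyapunov(2)[OF that] c_pos in \<open>simp add: field_simps\<close>)
    then show ?thesis by (simp add: LIM_zero_iff)
  qed
  \<comment> \<open>The endpoint formula rests on the multiplier update, hence starts at step 1; the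
    shift is removed afterwards.\<close>
  have "(\<lambda>k. s (Suc k) $ i) \<longlonglongrightarrow> x' $ i" for i
    using endpoints_tendsto(1)[OF inc g[of i] strict_mono_id] LIMSEQ_Suc[OF z_conv[OF g[of i]]] by simp
  then have "(\<lambda>k. s (Suc k)) \<longlonglongrightarrow> x'" by (rule vec_tendstoI)
  then have "s \<longlonglongrightarrow> x'" by (rule LIMSEQ_imp_Suc)
  then show ?thesis using kkt' lam_conv by blast
qed

end

section \<open>From the descent argument to the convergence theorem\<close>

lemma kkt_converges_to_optimal_pair:
  assumes "kkt N f x \<mu>" "s \<longlonglongrightarrow> x" "\<forall>e\<in>arcs N. (\<lambda>k. vb k e) \<longlonglongrightarrow> \<mu> e"
  shows "converges_to_optimal_pair N f s vb"
  unfolding converges_to_optimal_pair_def using assms kkt_imp_optimal_pair by blast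

text \<open>As there are no loops, one arc yields two distinct nodes, so every \<open>i\<close> has
  another node to reach; the first arc of such a path leaves \<open>i\<close>.\<close>

lemma connected_graph_neighbour:
  assumes "connected_graph N" "arcs N \<noteq> {}"
  shows "N i \<noteq> {}"
proof -
  obtain a b where "b \<in> N a" using assms(2) by (auto simp: arcs_def)
  then have "a \<noteq> b" using assms(1) by (auto simp: connected_graph_def)
  then obtain j where "j \<noteq> i" by metis
  moreover have "(i, j) \<in> (arcs N)\<^sup>*" using assms(1) by (simp add: connected_graph_def)
  ultimately obtain k where "(i, k) \<in> arcs N" by (auto elim: converse_rtranclE)
  then show ?thesis by (auto simp: arcs_def)
qed

lemma total_cost_convex:
  fixes f :: "'n::finite \<Rightarrow> real^'p::finite \<Rightarrow> real"
  assumes "\<And>i. convex_on UNIV (f i)"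
  shows "convex_on UNIV (total_cost f)"
proof (rule convex_onI)
  fix t :: real and x y :: "real^'p^'n" assume t: "0 < t" "t < 1"
  have "total_cost f ((1 - t) *\<^sub>R x + t *\<^sub>R y) \<le> (\<Sum>i\<in>UNIV. (1 - t) * f i (x $ i) + t * f i (y $ i))"
    unfolding total_cost_def using t convex_onD[OF assms] by (intro sum_mono) simp
  then show "total_cost f ((1 - t) *\<^sub>R x + t *\<^sub>R y) \<le> (1 - t) * total_cost f x + t * total_cost f y"
    by (simp add: total_cost_def sum.distrib sum_distrib_left)
qed simp

text \<open>The decentralized claim reduces to the ADMM claim by
  \<open>decentralized_imp_admm\<close>, so the descent argument is carried out only once.\<close>

theorem theorem1:
  fixes N :: "'n::finite \<Rightarrow> 'n set"
    and f :: "'n \<Rightarrow> real^'p::finite \<Rightarrow> real"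
    and c :: real
    and s :: "nat \<Rightarrow> real^'p^'n"
    and z vb vt :: "nat \<Rightarrow> 'n \<times> 'n \<Rightarrow> real^'p"
  assumes "connected_graph N"
    and "\<And>i. closed_proper_convex (f i)"
    and "\<exists>s' z' vb' vt'. optimal_pair N f s' z' vb' vt'"
    and "c > 0"
    and "multiplier_steps N c s z vb vt"
    and "z_steps N f c s z vb vt"
    and "\<forall>e\<in>arcs N. vb 0 e = - vt 0 e"
    and "\<forall>e\<in>arcs N. block_mult E_u UNIV (\<lambda>i. s 0 $ i) e = 2 *\<^sub>R z 0 e"
  shows "(decentralized_iterations N f c s (\<lambda>k. node_multiplier N (vb k)) \<and>
            reduction_valid N (vb 0) (vt 0) \<longrightarrow> converges_to_optimal_pair N f s vb) \<and>
         (admm_s_steps N f c s z vb vt \<longrightarrow> converges_to_optimal_pair N f s vb)"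
proof -
  have mid: "vb k e = - vt k e \<and> z k e = (1/2) *\<^sub>R (s k $ fst e + s k $ snd e)" if "e \<in> arcs N" for k e
    using admm_multipliers[OF assms(4-8)] that by blast
  have step: "vb (Suc k) e = vb k e + (c/2) *\<^sub>R (s (Suc k) $ fst e - s (Suc k) $ snd e)"
    if "e \<in> arcs N" for k e
  proof -
    have "vb (Suc k) e = vb k e + c *\<^sub>R (s (Suc k) $ fst e - z (Suc k) e)"
      using assms(5) that by (cases e) (fastforce simp: multiplier_steps_def)
    \<comment> \<open>Subtracting the midpoint leaves half of the endpoint difference, whence the
      factor \<open>c/2\<close>.\<close>
    moreover have "s (Suc k) $ fst e - z (Suc k) e = (1/2) *\<^sub>R (s (Suc k) $ fst e - s (Suc k) $ snd e)"
      unfolding mid[OF that, THEN conjunct2] by (simp add: vec_eq_iff field_simps)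
    ultimately show ?thesis by (simp only: scaleR_scaleR) simp
  qed
  have conv: "convex_on UNIV (total_cost f)"
    using assms(2) by (intro total_cost_convex) (simp add: closed_proper_convex_def)
  have admm: "converges_to_optimal_pair N f s vb" if steps: "admm_s_steps N f c s z vb vt"
  proof (cases "arcs N = {}")
    case True
    have arg_min: "unique_arg_min (total_cost f) (s (Suc k))" for k
      using steps True by (simp add: admm_s_steps_def aug_lagrangian_arcs lagrangian_arcs)
    \<comment> \<open>Without arcs every step has the objective \<open>total_cost f\<close>, and its
      unique minimizer fixes all iterates from step 1 on; \<open>s 0\<close> may differ.\<close>
    have const: "s (Suc k) = s 1" for k
      using arg_min[of 0] arg_min[of k] by (auto simp: unique_arg_min_def)
    have "s \<longlonglongrightarrow> s 1" by (rule LIMSEQ_imp_Suc) (unfold const, rule tendsto_const)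
    moreover have "total_cost f (s 1) \<le> total_cost f y" for y
      using arg_min[of 0] by (auto simp: unique_arg_min_def is_arg_min_linorder)
    \<comment> \<open>Without arcs any multiplier satisfies the condition; \<open>vb 0\<close> is
      merely a witness.\<close>
    then have "kkt N f (s 1) (vb 0)" using True by (simp add: kkt_def)
    ultimately show ?thesis using True by (intro kkt_converges_to_optimal_pair) auto
  next
    case False
    interpret edge_iterates N f c s z vb
    proof
      show "continuous_on UNIV (total_cost f)" using conv by (intro convex_on_continuous) auto
      show "total_cost f (s (Suc k)) \<le> total_cost f (s (Suc k) + d) +
        (\<Sum>e\<in>arcs N. vb (Suc k) e \<bullet> (d $ fst e - d $ snd e)
          + c * ((z (Suc k) e - z k e) \<bullet> (d $ fst e + d $ snd e)))" for k d
      proof (rule s_step_subgradient[OF conv])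
        show "\<forall>e\<in>arcs N. vb k e = - vt k e" using mid by blast
        show "is_arg_min (\<lambda>x. aug_lagrangian N f c x (z k) (case_sum (vb k) (vt k))) (\<lambda>_. True) (s (Suc k))"
          using steps unfolding admm_s_steps_def unique_arg_min_def by blast
      qed (rule mid[THEN conjunct2] step, assumption)+
    qed (rule assms(4) mid[THEN conjunct2] step, assumption?)+
    obtain x \<mu> where "kkt N f x \<mu>" using assms(3) optimal_pair_imp_kkt by blast
    from converges[OF this connected_graph_neighbour[OF assms(1) False]]
    show ?thesis using kkt_converges_to_optimal_pair by blast
  qed
  have "\<forall>i j. j \<in> N i \<longleftrightarrow> i \<in> N j" using assms(1) by (simp add: connected_graph_def)
  then have "admm_s_steps N f c s z vb vt"
    if "decentralized_iterations N f c s (\<lambda>k. node_multiplier N (vb k))" "reduction_valid N (vb 0) (vt 0)"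
    using decentralized_imp_admm mid step that by blast
  then show ?thesis using admm by blast
qed

end
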